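(* Let $V$ be a simple Euclidean Jordan algebra of rank $r\ge 3$, with cone of squares $Q$. Then $V$ does not contain lattice-like hyperplanes; that is, no hyperplane of $V$ is a lattice-like subset of $(V,Q)$.
   Context: A Euclidean Jordan algebra $V$ is a finite-dimensional real vector space with a commutative bilinear product $(x,y)\mapsto xy$ satisfying $x^2(xy)=x(x^2y)$, with a unit element $e$, and with an inner product $\langle\cdot,\cdot\rangle$ such that $\langle xy,z\rangle=\langle y,xz\rangle$ for all $x,y,z\in V$. Its cone of squares is $Q=\{x^2: x\in V\}$, a closed convex self-dual cone. $V$ is simple if it contains no nontrivial ideal. The rank of $V$ is the common number $r$ of elements of its Jordan frames, a Jordan frame being a set $\{c_1,\dots,c_r\}$ of primitive idempotents with $c_ic_j=0$ for $i\ne j$ and $c_1+\dots+c_r=e$. A hyperplane is a set $H(u,a)=\{x\in V:\langle a,x\rangle=\langle a,u\rangle\}$ with $u,a\in V$, $a\neq 0$. For a nonempty closed convex set $D\subset V$, $P_D$ denotes the metric (nearest point) projection onto $D$. The lattice-like operations are $x\sqcap_Q y=P_{x-Q}\,y$ and $x\sqcup_Q y=P_{x+Q}\,y$. A set $M\subset V$ is lattice-like in $(V,Q)$ if $x\sqcap_Q y\in M$ and $x\sqcup_Q y\in M$ for all $x,y\in M$. *)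

theory Defs
  imports "HOL-Analysis.Analysis"
begin

(* The carrier is a whole type of class euclidean_space and the associative inner product is
   that of the class. Every nonzero finite-dimensional real inner product space is isometric to
   such a type; the zero algebra, of rank 0, is left out. *)
locale euclidean_jordan_algebra =
  fixes jmul :: "'a::euclidean_space \<Rightarrow> 'a \<Rightarrow> 'a" (infixl \<open>\<odot>\<close> 70)
    and e :: 'a
  assumes bilinear_mult: "bilinear (\<odot>)"
    and mult_commute: "x \<odot> y = y \<odot> x"
    and jordan_identity: "(x \<odot> x) \<odot> (x \<odot> y) = x \<odot> ((x \<odot> x) \<odot> y)"
    and mult_unit: "e \<odot> x = x"
    and inner_mult: "inner (x \<odot> y) z = inner y (x \<odot> z)"

definition cone_of_squares :: "('a::euclidean_space \<Rightarrow> 'a \<Rightarrow> 'a) \<Rightarrow> 'a set" where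
  "cone_of_squares jmul = {jmul x x | x. True}"

(* As the product is commutative, one-sided absorption suffices. *)
definition jordan_ideal :: "('a::euclidean_space \<Rightarrow> 'a \<Rightarrow> 'a) \<Rightarrow> 'a set \<Rightarrow> bool" where
  "jordan_ideal jmul I \<longleftrightarrow> subspace I \<and> (\<forall>x\<in>I. \<forall>y. jmul x y \<in> I)"

definition simple_jordan :: "('a::euclidean_space \<Rightarrow> 'a \<Rightarrow> 'a) \<Rightarrow> bool" where
  "simple_jordan jmul \<longleftrightarrow> (\<forall>I. jordan_ideal jmul I \<longrightarrow> I = {0} \<or> I = UNIV)"

definition jordan_idempotent :: "('a::euclidean_space \<Rightarrow> 'a \<Rightarrow> 'a) \<Rightarrow> 'a \<Rightarrow> bool" where
  "jordan_idempotent jmul c \<longleftrightarrow> jmul c c = c"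

(* Two idempotents whose sum is idempotent are automatically orthogonal. *)
definition primitive_idempotent :: "('a::euclidean_space \<Rightarrow> 'a \<Rightarrow> 'a) \<Rightarrow> 'a \<Rightarrow> bool" where
  "primitive_idempotent jmul c \<longleftrightarrow>
     jordan_idempotent jmul c \<and> c \<noteq> 0 \<and>
     \<not> (\<exists>a b. jordan_idempotent jmul a \<and> jordan_idempotent jmul b \<and>
            a \<noteq> 0 \<and> b \<noteq> 0 \<and> c = a + b)"

definition jordan_frame :: "('a::euclidean_space \<Rightarrow> 'a \<Rightarrow> 'a) \<Rightarrow> 'a \<Rightarrow> 'a set \<Rightarrow> bool" where
  "jordan_frame jmul e C \<longleftrightarrow>
     finite C \<and> (\<forall>c\<in>C. primitive_idempotent jmul c) \<and>
     (\<forall>c\<in>C. \<forall>d\<in>C. c \<noteq> d \<longrightarrow> jmul c d = 0) \<and> \<Sum>C = e"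

(* In a Euclidean Jordan algebra Jordan frames exist and all have the same cardinality,
   so the choice of the frame is immaterial. *)
definition jordan_rank :: "('a::euclidean_space \<Rightarrow> 'a \<Rightarrow> 'a) \<Rightarrow> 'a \<Rightarrow> nat" where
  "jordan_rank jmul e = card (SOME C. jordan_frame jmul e C)"

definition hyperplane :: "'a::euclidean_space \<Rightarrow> 'a \<Rightarrow> 'a set" where
  "hyperplane u a = {x. inner a x = inner a u}"

(* closest_point D is the metric projection onto D. *)
definition cone_inf :: "'a::euclidean_space set \<Rightarrow> 'a \<Rightarrow> 'a \<Rightarrow> 'a" where
  "cone_inf Q x y = closest_point {x - q | q. q \<in> Q} y"

definition cone_sup :: "'a::euclidean_space set \<Rightarrow> 'a \<Rightarrow> 'a \<Rightarrow> 'a" where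
  "cone_sup Q x y = closest_point {x + q | q. q \<in> Q} y"

definition lattice_like :: "'a::euclidean_space set \<Rightarrow> 'a set \<Rightarrow> bool" where
  "lattice_like Q M \<longleftrightarrow> (\<forall>x\<in>M. \<forall>y\<in>M. cone_inf Q x y \<in> M \<and> cone_sup Q x y \<in> M)"

end

(* Moving the hyperplane to the origin, lattice-likeness says that the positive part of every z
   orthogonal to a is again orthogonal to a. Hence a cannot have inner products of the same strict
   sign with two orthogonal elements of the cone of squares. Applied to the spectral idempotents of a,
   this leaves a = l c + m d with orthogonal idempotents c, d.

   Put f = e - c - d. If f is nonzero, then an element x of the Peirce space of (c, f) splits into
   orthogonal positive and negative parts on which a takes equal values, so x = 0; the same holds for
   (d, f), and then the Peirce 1-space of f is a proper ideal, contradicting simplicity. If f = 0, then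
   c and d span their Peirce 1-spaces, so every element satisfies a quadratic equation over the unit,
   whereas p + 2 q does not when p, q, r are distinct members of a Jordan frame.

   The spectral decomposition is obtained by splitting off eigenvectors of L(x) in the span of the
   powers of x, which is associative by the Jordan identity. *)
theory Submission
  imports Defs
begin

section \<open>Eigenvectors of self-adjoint maps on invariant subspaces\<close>

text \<open>A maximiser \<open>v\<close> of the quadratic form of \<open>f\<close> on the unit
  sphere of \<open>S\<close> works: the form of \<open>g\<close> is nonnegative on \<open>S\<close>
  and vanishes at \<open>v\<close>, which forces \<open>g v = 0\<close>.\<close>

lemma selfadjoint_eigenvector:
  fixes f :: "'a::euclidean_space \<Rightarrow> 'a"
  assumes lin: "linear f" and sub: "subspace S" and inv: "\<And>y. y \<in> S \<Longrightarrow> f y \<in> S"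
    and sa: "\<And>y z. inner (f y) z = inner y (f z)" and ex: "\<exists>y\<in>S. y \<noteq> 0"
  obtains v l where "v \<in> S" "v \<noteq> 0" "f v = l *\<^sub>R v"
proof -
  let ?K = "S \<inter> sphere 0 1"
  obtain y0 where y0: "y0 \<in> S" "y0 \<noteq> 0" using ex by blast
  have "compact ?K" using closed_subspace[OF sub] by (simp add: closed_Int_compact)
  moreover have "y0 /\<^sub>R norm y0 \<in> ?K"
    using y0 sub by (simp add: subspace_scale)
  moreover have "continuous_on ?K (\<lambda>y. inner (f y) y)"
    using lin by (intro continuous_intros linear_continuous_on) (simp add: linear_conv_bounded_linear)
  ultimately obtain v where v: "v \<in> ?K" and vmax: "\<And>y. y \<in> ?K \<Longrightarrow> inner (f y) y \<le> inner (f v) v"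
    using continuous_attains_sup[of ?K "\<lambda>y. inner (f y) y"] by blast
  define l where "l = inner (f v) v"
  have vS: "v \<in> S" and v1: "norm v = 1" using v by auto
  have le: "inner (f y) y \<le> l * inner y y" if "y \<in> S" for y
  proof (cases "y = 0")
    case True then show ?thesis by simp
  next
    case False
    then have "y /\<^sub>R norm y \<in> ?K" using that sub by (simp add: subspace_scale)
    from vmax[OF this] have "inner (f (y /\<^sub>R norm y)) (y /\<^sub>R norm y) \<le> l" by (simp add: l_def)
    then have "inner (f y) y / (norm y)\<^sup>2 \<le> l"
      using lin by (simp add: linear_scale power2_eq_square divide_inverse mult_ac)
    then show ?thesis using False by (simp add: divide_le_eq dot_square_norm)
  qed
  define g where "g = (\<lambda>y. l *\<^sub>R y - f y)"
  have "linear g" unfolding g_def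
    using lin by (intro linear_compose_sub linear_scale_self)
  define w where "w = g v"
  have wS: "w \<in> S" unfolding w_def g_def using vS sub inv by (simp add: subspace_scale subspace_diff)
  have gpos: "inner (g y) y \<ge> 0" if "y \<in> S" for y
    using le[OF that] by (simp add: g_def inner_diff_left)
  define k where "k = inner (g w) w"
  have k0: "k \<ge> 0" using gpos wS k_def by simp
  \<comment> \<open>The form of \<open>g\<close> at \<open>v + t *\<^sub>R w\<close> is
    \<open>2 * t * inner w w + t * t * k\<close>, negative for this \<open>t\<close> unless
    \<open>w = 0\<close>. The denominator \<open>k + 1\<close> instead of the minimising
    \<open>k\<close> also covers \<open>k = 0\<close>.\<close>
  define t where "t = - inner w w / (k + 1)"
  have gadd: "g (v + t *\<^sub>R w) = w + t *\<^sub>R g w"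
    using \<open>linear g\<close> by (simp add: w_def linear_add linear_scale)
  have wv: "inner w v = 0"
    using v1 by (simp add: w_def g_def inner_diff_left l_def dot_square_norm)
  have "inner (g w) v = inner w w"
    by (simp add: g_def w_def inner_diff_left inner_diff_right sa)
  then have "0 \<le> 2 * t * inner w w + t * t * k"
    using gpos[of "v + t *\<^sub>R w"] vS wS sub wv
    by (simp add: gadd subspace_add subspace_scale inner_add_left inner_add_right k_def algebra_simps)
  then have "0 \<le> (2 * t * inner w w + t * t * k) * (k + 1)\<^sup>2" by simp
  also have "\<dots> = 2 * (t * (k + 1)) * inner w w * (k + 1) + (t * (k + 1))\<^sup>2 * k"
    by (simp add: power2_eq_square algebra_simps)
  also have "t * (k + 1) = - inner w w" using k0 by (simp add: t_def)
  finally have "(inner w w)\<^sup>2 * (k + 2) \<le> 0"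
    by (simp add: power2_eq_square algebra_simps)
  then have "w = 0" using k0 by (simp add: mult_le_0_iff)
  then have "f v = l *\<^sub>R v" by (simp add: w_def g_def)
  then show thesis using that vS v1 by force
qed

context euclidean_jordan_algebra
begin

subsection \<open>Linearized Jordan identity and Peirce decomposition\<close>

lemmas jadd_left = bilinear_ladd[OF bilinear_mult]
lemmas jadd_right = bilinear_radd[OF bilinear_mult]
lemmas jscale_left = bilinear_lmul[OF bilinear_mult]
lemmas jscale_right = bilinear_rmul[OF bilinear_mult]
lemmas jdiff_left = bilinear_lsub[OF bilinear_mult]
lemmas jdiff_right = bilinear_rsub[OF bilinear_mult]
lemmas jzero_left [simp] = bilinear_lzero[OF bilinear_mult]
lemmas jzero_right [simp] = bilinear_rzero[OF bilinear_mult]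
lemmas jminus_left = bilinear_lneg[OF bilinear_mult]
lemmas jminus_right = bilinear_rneg[OF bilinear_mult]
lemmas jbilinear = jadd_left jadd_right jscale_left jscale_right jdiff_left jdiff_right
  jminus_left jminus_right

lemma linear_jmul: "linear (\<lambda>y. x \<odot> y)"
  using bilinear_mult by (simp add: bilinear_def)

lemma jsum_right: "x \<odot> (\<Sum>i\<in>I. f i) = (\<Sum>i\<in>I. x \<odot> f i)"
  using linear_sum[OF linear_jmul] by blast

lemma mult_unit_right [simp]: "x \<odot> e = x"
  using mult_commute mult_unit by metis

declare mult_unit [simp]

lemma inner_mult': "inner x (y \<odot> z) = inner (x \<odot> y) z"
  by (metis inner_mult mult_commute)

lemma inner_square_unit: "inner (x \<odot> x) e = inner x x"
  by (simp add: inner_mult)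

lemma square_eq_0 [simp]: "x \<odot> x = 0 \<longleftrightarrow> x = 0"
  using inner_square_unit[of x] by auto

text \<open>Polarization: both sides of the Jordan identity are cubic in \<open>x\<close>, and
  inclusion-exclusion over the sums of \<open>x\<close>, \<open>y\<close>, \<open>z\<close> isolates
  the trilinear part. Pairing with \<open>t\<close> leaves linear arithmetic over the reals.\<close>

lemma linearized_jordan:
  "(x \<odot> y) \<odot> (z \<odot> w) + (y \<odot> z) \<odot> (x \<odot> w) + (z \<odot> x) \<odot> (y \<odot> w) =
   z \<odot> ((x \<odot> y) \<odot> w) + x \<odot> ((y \<odot> z) \<odot> w) + y \<odot> ((z \<odot> x) \<odot> w)"
proof (rule vector_eq_rdot[THEN iffD1], rule allI)
  fix t
  let ?F = "\<lambda>x. inner ((x \<odot> x) \<odot> (x \<odot> w)) t = inner (x \<odot> ((x \<odot> x) \<odot> w)) t"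
  have F: "?F x" for x by (simp add: jordan_identity)
  have c: "y \<odot> x = x \<odot> y" "z \<odot> y = y \<odot> z" "x \<odot> z = z \<odot> x" by (rule mult_commute)+
  show "inner ((x \<odot> y) \<odot> (z \<odot> w) + (y \<odot> z) \<odot> (x \<odot> w) + (z \<odot> x) \<odot> (y \<odot> w)) t =
    inner (z \<odot> ((x \<odot> y) \<odot> w) + x \<odot> ((y \<odot> z) \<odot> w) + y \<odot> ((z \<odot> x) \<odot> w)) t"
    using F[of "x + y + z"] F[of "x + y"] F[of "y + z"] F[of "z + x"] F[of x] F[of y] F[of z]
    unfolding jadd_left jadd_right inner_add_left c by linarith
qed

(* Both sides of the linearized identity are read as operators in w: the left side is symmetric in
   all four arguments, so z and w may be exchanged on the right. *)
lemma mult_triple: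
  "((x \<odot> y) \<odot> z) \<odot> w =
   z \<odot> ((x \<odot> y) \<odot> w) + x \<odot> ((y \<odot> z) \<odot> w) + y \<odot> ((z \<odot> x) \<odot> w)
   - x \<odot> (z \<odot> (y \<odot> w)) - y \<odot> (z \<odot> (x \<odot> w))"
proof -
  have "(x \<odot> y) \<odot> (z \<odot> w) + (y \<odot> z) \<odot> (x \<odot> w) + (z \<odot> x) \<odot> (y \<odot> w) =
    (x \<odot> y) \<odot> (w \<odot> z) + (y \<odot> w) \<odot> (x \<odot> z) + (w \<odot> x) \<odot> (y \<odot> z)"
    by (simp add: mult_commute add_ac)
  then have "z \<odot> ((x \<odot> y) \<odot> w) + x \<odot> ((y \<odot> z) \<odot> w) + y \<odot> ((z \<odot> x) \<odot> w) =
    w \<odot> ((x \<odot> y) \<odot> z) + x \<odot> ((y \<odot> w) \<odot> z) + y \<odot> ((w \<odot> x) \<odot> z)"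
    by (simp only: linearized_jordan)
  then show ?thesis by (simp add: mult_commute algebra_simps)
qed

primrec jpow :: "'a \<Rightarrow> nat \<Rightarrow> 'a" where
  "jpow x 0 = e"
| "jpow x (Suc n) = x \<odot> jpow x n"

text \<open>By \<open>mult_triple\<close>, multiplication by \<open>jpow x (Suc (Suc k))\<close> is
  a polynomial in the multiplications by \<open>x\<close>, \<open>x \<odot> x\<close>,
  \<open>jpow x k\<close> and \<open>jpow x (Suc k)\<close>, which commute with that by
  \<open>x\<close> by induction and the Jordan identity.\<close>

lemma jpow_commute: "jpow x n \<odot> (x \<odot> w) = x \<odot> (jpow x n \<odot> w)"
proof (induction n arbitrary: w rule: less_induct)
  case (less n)
  consider "n = 0" | "n = 1" | k where "n = Suc (Suc k)"
    by (metis One_nat_def not0_implies_Suc)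
  then show ?case
  proof cases
    case 3
    let ?m = "Suc k"
    have IH0: "jpow x k \<odot> (x \<odot> w) = x \<odot> (jpow x k \<odot> w)" for w using less 3 by simp
    have IH1: "jpow x ?m \<odot> (x \<odot> w) = x \<odot> (jpow x ?m \<odot> w)" for w using less 3 by blast
    have n: "jpow x n = jpow x ?m \<odot> x" using 3 by (simp add: mult_commute)
    have c: "jpow x k \<odot> x = x \<odot> jpow x k" by (rule mult_commute)
    have m: "x \<odot> jpow x k = jpow x ?m" by simp
    have "jpow x n \<odot> w = x \<odot> (jpow x ?m \<odot> w) + x \<odot> (jpow x ?m \<odot> w) + jpow x k \<odot> ((x \<odot> x) \<odot> w)
        - x \<odot> (x \<odot> (jpow x k \<odot> w)) - jpow x k \<odot> (x \<odot> (x \<odot> w))" for w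
      using mult_triple[of x "jpow x k" x w] by (simp only: n c m)
    then show ?thesis
      by (simp only: jbilinear IH0 IH1 jordan_identity)
  qed simp_all
qed

text \<open>\<open>mult_triple\<close> with three factors \<open>c\<close>. The polynomial has the
  roots 0, 1/2, 1, hence the three Peirce spaces.\<close>

lemma peirce_cubic:
  assumes "c \<odot> c = c"
  shows "c \<odot> w + 2 *\<^sub>R (c \<odot> (c \<odot> (c \<odot> w))) = 3 *\<^sub>R (c \<odot> (c \<odot> w))"
proof -
  have "c \<odot> w = c \<odot> (c \<odot> w) + c \<odot> (c \<odot> w) + c \<odot> (c \<odot> w)
      - c \<odot> (c \<odot> (c \<odot> w)) - c \<odot> (c \<odot> (c \<odot> w))"
    using mult_triple[of c c c w] assms by simp
  then have "c \<odot> w + (c \<odot> (c \<odot> (c \<odot> w)) + c \<odot> (c \<odot> (c \<odot> w)))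
      = c \<odot> (c \<odot> w) + c \<odot> (c \<odot> w) + c \<odot> (c \<odot> w)"
    by (simp add: algebra_simps)
  moreover have "(3::real) = 1 + 1 + 1" by simp
  ultimately show ?thesis by (simp only: scaleR_2 scaleR_add_left scaleR_one)
qed

lemma peirce_0_commute:
  assumes "c \<odot> c = c" "c \<odot> z = 0"
  shows "c \<odot> (z \<odot> w) = z \<odot> (c \<odot> w)"
  using linearized_jordan[of c c z w] assms mult_commute[of z c] by simp

lemma peirce_1_commute:
  assumes "c \<odot> c = c" "c \<odot> z = z"
  shows "c \<odot> (z \<odot> w) = z \<odot> (c \<odot> w)"
  using linearized_jordan[of c c z w] assms mult_commute[of z c] by simp

text \<open>Moving \<open>c\<close> past \<open>z\<close> shows that \<open>c\<close> fixes the
  product; moving it past \<open>w\<close> shows that \<open>c\<close> kills it.\<close>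

lemma peirce_0_1_orthogonal:
  assumes "c \<odot> c = c" "c \<odot> z = 0" "c \<odot> w = w"
  shows "z \<odot> w = 0"
proof -
  have "c \<odot> (z \<odot> w) = z \<odot> w" using peirce_0_commute[of c z w] assms by simp
  moreover have "c \<odot> (w \<odot> z) = 0" using peirce_1_commute[of c w z] assms by simp
  ultimately show ?thesis by (metis mult_commute)
qed

(* L(c) = P1 + P2 / 2 with the self-adjoint Peirce projections P1 = 2 L(c)^2 - L(c) and
   P2 = 4 L(c) - 4 L(c)^2. *)
lemma idempotent_inner_eq:
  assumes "c \<odot> c = c"
  shows "inner (c \<odot> w) w = (norm (2 *\<^sub>R (c \<odot> (c \<odot> w)) - c \<odot> w))\<^sup>2
    + 2 * (norm (2 *\<^sub>R (c \<odot> w) - 2 *\<^sub>R (c \<odot> (c \<odot> w))))\<^sup>2"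
proof -
  define m where "m = (\<lambda>y. inner y w)"
  have r: "inner (c \<odot> y) (c \<odot> z) = inner (c \<odot> (c \<odot> y)) z" for y z
    by (simp add: inner_mult)
  have p: "inner (c \<odot> y) w + 2 * inner (c \<odot> (c \<odot> (c \<odot> y))) w = 3 * inner (c \<odot> (c \<odot> y)) w" for y
    using arg_cong[OF peirce_cubic[OF assms, of y], of m]
    by (simp add: m_def inner_add_left)
  show ?thesis
    using p[of w] p[of "c \<odot> w"]
    by (simp add: power2_norm_eq_inner inner_diff_left inner_diff_right r algebra_simps)
qed

lemma idempotent_inner_nonneg: "c \<odot> c = c \<Longrightarrow> inner (c \<odot> w) w \<ge> 0"
  by (subst idempotent_inner_eq) simp_all

lemma idempotent_inner_eq_0:
  assumes "c \<odot> c = c" "inner (c \<odot> w) w = 0"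
  shows "c \<odot> w = 0"
proof -
  let ?A = "2 *\<^sub>R (c \<odot> (c \<odot> w)) - c \<odot> w"
  let ?B = "2 *\<^sub>R (c \<odot> w) - 2 *\<^sub>R (c \<odot> (c \<odot> w))"
  have "(norm ?A)\<^sup>2 = 0 \<and> (norm ?B)\<^sup>2 = 0"
    using idempotent_inner_eq[of c w] assms zero_le_power2[of "norm ?A"] zero_le_power2[of "norm ?B"]
    by linarith
  then have "?A + ?B = 0" "?A = 0" by (simp_all only: zero_eq_power2 norm_eq_zero add_0)
  moreover have "?A + ?B = c \<odot> w" by (simp add: algebra_simps) (simp add: scaleR_2)
  ultimately show ?thesis by simp
qed

subsection \<open>Spectral decomposition\<close>

text \<open>Non-unital, so that the Peirce 0- and 1-spaces of an idempotent count.\<close>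

definition subalgebra :: "'a set \<Rightarrow> bool" where
  "subalgebra B \<longleftrightarrow> subspace B \<and> (\<forall>y\<in>B. \<forall>z\<in>B. y \<odot> z \<in> B)"

lemma subspace_eigenspace: "subspace {y. c \<odot> y = k *\<^sub>R y}"
  by (auto simp: subspace_def jbilinear algebra_simps)

lemma subalgebra_peirce_0: "c \<odot> c = c \<Longrightarrow> subalgebra {y. c \<odot> y = 0}"
  using subspace_eigenspace[of c 0] by (simp add: subalgebra_def peirce_0_commute)

lemma subalgebra_peirce_1: "c \<odot> c = c \<Longrightarrow> subalgebra {y. c \<odot> y = y}"
  using subspace_eigenspace[of c 1] by (simp add: subalgebra_def peirce_1_commute)

lemma subalgebra_Int: "subalgebra A \<Longrightarrow> subalgebra B \<Longrightarrow> subalgebra (A \<inter> B)"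
  by (simp add: subalgebra_def subspace_inter)

text \<open>Take an eigenvector \<open>v\<close> of multiplication by \<open>x\<close> inside the
  span \<open>A\<close> of the powers of \<open>x\<close>. Since \<open>v\<close> lies in
  \<open>A\<close>, its multiplication commutes with that by \<open>x\<close>, so all of
  \<open>A\<close>, and \<open>v\<close> itself, multiplies \<open>v\<close> by scalars. Rescaling
  \<open>v\<close> gives the idempotent.\<close>

lemma subalgebra_contains_eigen_idempotent:
  assumes B: "subalgebra B" and x: "x \<in> B" "x \<noteq> 0"
  obtains c l where "c \<in> B" "c \<odot> c = c" "c \<noteq> 0" "x \<odot> c = l *\<^sub>R c"
proof -
  \<comment> \<open>Powers start at \<open>x\<close>, not at \<open>e\<close>, to stay inside
    \<open>B\<close>.\<close>
  define A where "A = span (range (\<lambda>n. jpow x (Suc n)))"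
  have pB: "jpow x (Suc n) \<in> B" for n
    by (induction n) (use B x in \<open>auto simp: subalgebra_def\<close>)
  have AB: "A \<subseteq> B" unfolding A_def
    using B pB by (intro span_minimal) (auto simp: subalgebra_def)
  have inv: "x \<odot> y \<in> A" if "y \<in> A" for y
    using that unfolding A_def
  proof (induction rule: span_induct)
    case base
    show ?case by (auto simp: subspace_def jbilinear intro: span_zero span_add span_scale)
  next
    case (step y)
    then obtain n where "y = jpow x (Suc n)" by auto
    then have "x \<odot> y = jpow x (Suc (Suc n))" by simp
    then show ?case by (metis rangeI span_base)
  qed
  have comm: "y \<odot> (x \<odot> w) = x \<odot> (y \<odot> w)" if "y \<in> A" for y w
    using that unfolding A_def
  proof (induction rule: span_induct)
    case base
    show ?case by (auto simp: subspace_def jbilinear)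
  next
    case (step y)
    then show ?case using jpow_commute by blast
  qed
  have "x = jpow x (Suc 0)" by simp
  then have xA: "x \<in> A" unfolding A_def by (metis rangeI span_base)
  obtain v l where v: "v \<in> A" "v \<noteq> 0" "x \<odot> v = l *\<^sub>R v"
  proof (rule selfadjoint_eigenvector[of "\<lambda>y. x \<odot> y" A])
    show "inner (x \<odot> y) z = inner y (x \<odot> z)" for y z by (rule inner_mult)
  qed (use linear_jmul inv xA x in \<open>auto simp: A_def\<close>)
  have "\<exists>m. y \<odot> v = m *\<^sub>R v" if "y \<in> A" for y
    using that unfolding A_def
  proof (induction rule: span_induct)
    case base
    show ?case
      unfolding subspace_def
    proof (intro conjI allI ballI)
      show "0 \<in> {y. \<exists>m. y \<odot> v = m *\<^sub>R v}" by (auto intro: exI[of _ 0])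
    qed (auto simp: jbilinear scaleR_add_left[symmetric])
  next
    case (step y)
    then obtain n where n: "y = jpow x (Suc n)" by auto
    have "jpow x m \<odot> v = (l ^ m) *\<^sub>R v" for m
    proof (induction m)
      case (Suc m)
      have "jpow x (Suc m) \<odot> v = v \<odot> (x \<odot> jpow x m)" by (simp add: mult_commute)
      also have "\<dots> = x \<odot> (jpow x m \<odot> v)" 
        unfolding comm[OF v(1)] by (subst mult_commute[of v]) (rule refl)
      finally show ?case using Suc v by (simp add: jbilinear)
    qed simp
    then show ?case unfolding n by blast
  qed
  then obtain m where m: "v \<odot> v = m *\<^sub>R v" using v by blast
  have "m \<noteq> 0" using m v by auto
  define c where "c = v /\<^sub>R m"
  have "c \<in> B" using v AB B unfolding c_def subalgebra_def by (auto intro: subspace_scale)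
  moreover have "c \<odot> c = c" using m \<open>m \<noteq> 0\<close> by (simp add: c_def jbilinear)
  moreover have "c \<noteq> 0" using v \<open>m \<noteq> 0\<close> by (simp add: c_def)
  moreover have "x \<odot> c = l *\<^sub>R c" using v by (simp add: c_def jbilinear)
  ultimately show thesis using that by blast
qed

text \<open>A Jordan frame without primitivity and without the sum being \<open>e\<close>; it serves
  both for spectra and for frames.\<close>

definition idempotent_system :: "'a set \<Rightarrow> bool" where
  "idempotent_system C \<longleftrightarrow> finite C \<and> (\<forall>c\<in>C. c \<odot> c = c \<and> c \<noteq> 0) \<and>
     (\<forall>c\<in>C. \<forall>d\<in>C. c \<noteq> d \<longrightarrow> c \<odot> d = 0)"

lemma idempotent_system_mult:
  assumes "idempotent_system C"
  shows "(\<Sum>c\<in>C. l c *\<^sub>R c) \<odot> (\<Sum>c\<in>C. m c *\<^sub>R c) = (\<Sum>c\<in>C. (l c * m c) *\<^sub>R c)"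
proof -
  have *: "d \<odot> (\<Sum>c\<in>C. m c *\<^sub>R c) = m d *\<^sub>R d" if "d \<in> C" for d
  proof -
    have "d \<odot> (\<Sum>c\<in>C. m c *\<^sub>R c) = (\<Sum>c\<in>C. if c = d then m d *\<^sub>R d else 0)"
      unfolding jsum_right
      by (intro sum.cong) (use assms that in \<open>auto simp: idempotent_system_def jbilinear\<close>)
    then show ?thesis using assms that by (simp add: idempotent_system_def)
  qed
  have "(\<Sum>c\<in>C. l c *\<^sub>R c) \<odot> y = (\<Sum>c\<in>C. l c *\<^sub>R (c \<odot> y))" for y
    by (subst mult_commute) (simp add: jsum_right jbilinear mult_commute)
  then show ?thesis by (simp add: * cong: sum.cong)
qed

text \<open>Split off an eigen-idempotent \<open>c\<close> with eigenvalue \<open>k\<close>: the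
  rest \<open>x - k *\<^sub>R c\<close> lies in the Peirce 0-space of \<open>c\<close> within
  \<open>B\<close>, a subalgebra of smaller dimension whose elements all annihilate
  \<open>c\<close>.\<close>

lemma spectral_decomposition:
  assumes "subalgebra B" "x \<in> B"
  obtains C l where "idempotent_system C" "C \<subseteq> B" "x = (\<Sum>c\<in>C. l c *\<^sub>R c)"
  using assms
proof (induction "dim B" arbitrary: B x thesis rule: less_induct)
  case less
  show ?case
  proof (cases "x = 0")
    case True
    then show ?thesis using less.prems(1)[of "{}"] by (simp add: idempotent_system_def)
  next
    case False
    obtain c k where c: "c \<in> B" "c \<odot> c = c" "c \<noteq> 0" "x \<odot> c = k *\<^sub>R c"
      using subalgebra_contains_eigen_idempotent[OF less.prems(2,3) False] .
    let ?D = "B \<inter> {y. c \<odot> y = 0}"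
    have D: "subalgebra ?D" using subalgebra_Int[OF less.prems(2) subalgebra_peirce_0[OF c(2)]] .
    have "c \<notin> ?D" using c by simp
    then have "?D \<subset> B" using c(1) by blast
    then have "dim ?D < dim B"
      using D less.prems(2) by (intro dim_psubset) (auto simp: subalgebra_def span_eq_iff[THEN iffD2])
    moreover have "x - k *\<^sub>R c \<in> ?D"
      using c less.prems(2,3) mult_commute[of c x]
      by (auto simp: subalgebra_def subspace_diff subspace_scale jbilinear)
    ultimately obtain C l where C: "idempotent_system C" "C \<subseteq> ?D" "x - k *\<^sub>R c = (\<Sum>c\<in>C. l c *\<^sub>R c)"
      using less.hyps[OF _ _ D] by blast
    have "c \<notin> C" using C c by auto
    have "finite C" using C by (simp add: idempotent_system_def)
    have "d \<odot> c = 0" if "d \<in> C" for d using C that mult_commute[of c d] by auto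
    then have "idempotent_system (insert c C)"
      using C c by (auto simp: idempotent_system_def)
    moreover have "insert c C \<subseteq> B" using C c by auto
    moreover have "x = (\<Sum>d\<in>insert c C. (l(c := k)) d *\<^sub>R d)"
    proof -
      have "(\<Sum>d\<in>C. (l(c := k)) d *\<^sub>R d) = (\<Sum>d\<in>C. l d *\<^sub>R d)"
        using \<open>c \<notin> C\<close> by (intro sum.cong) auto
      then show ?thesis
        using \<open>c \<notin> C\<close> \<open>finite C\<close> by (simp flip: C(3))
    qed
    ultimately show ?thesis using less.prems(1) by blast
  qed
qed

lemma sum_scaleR_mem_subalgebra:
  "subalgebra B \<Longrightarrow> C \<subseteq> B \<Longrightarrow> (\<Sum>c\<in>C. l c *\<^sub>R c) \<in> B"
  unfolding subalgebra_def by (blast intro: subspace_sum subspace_scale)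

text \<open>Functional calculus on the spectral coefficients: the roots of their positive and
  negative parts define \<open>v\<close> and \<open>w\<close>, which stay in
  \<open>B\<close>.\<close>

lemma positive_negative_parts:
  assumes B: "subalgebra B" and "x \<in> B"
  obtains v w where "v \<in> B" "w \<in> B" "x = v \<odot> v - w \<odot> w" "inner (v \<odot> v) (w \<odot> w) = 0"
proof -
  obtain C l where C: "idempotent_system C" "C \<subseteq> B" "x = (\<Sum>c\<in>C. l c *\<^sub>R c)"
    using spectral_decomposition[OF assms] .
  define v where "v = (\<Sum>c\<in>C. sqrt (max (l c) 0) *\<^sub>R c)"
  define w where "w = (\<Sum>c\<in>C. sqrt (max (- l c) 0) *\<^sub>R c)"
  have vv: "v \<odot> v = (\<Sum>c\<in>C. max (l c) 0 *\<^sub>R c)"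
    unfolding v_def idempotent_system_mult[OF C(1)] by simp
  have ww: "w \<odot> w = (\<Sum>c\<in>C. max (- l c) 0 *\<^sub>R c)"
    unfolding w_def idempotent_system_mult[OF C(1)] by simp
  have "v \<in> B" "w \<in> B" unfolding v_def w_def by (rule sum_scaleR_mem_subalgebra[OF B C(2)])+
  moreover have "x = v \<odot> v - w \<odot> w"
    unfolding C(3) vv ww sum_subtractf[symmetric]
    by (intro sum.cong refl) (auto simp: max_def)
  moreover have "(v \<odot> v) \<odot> (w \<odot> w) = 0"
    unfolding vv ww idempotent_system_mult[OF C(1)]
    by (intro sum.neutral) (auto simp: max_def)
  then have "inner (v \<odot> v) (w \<odot> w) = 0"
    using inner_mult[of "v \<odot> v" "w \<odot> w" e] by (simp add: inner_commute)
  ultimately show thesis using that by blast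
qed

text \<open>One half of self-duality of the cone: \<open>x \<odot> x\<close> is a nonnegative
  combination of idempotents, and multiplication by an idempotent is positive semidefinite.\<close>

lemma inner_squares_nonneg: "inner (x \<odot> x) (y \<odot> y) \<ge> 0"
proof -
  have "subalgebra UNIV" by (simp add: subalgebra_def)
  then obtain C l where C: "idempotent_system C" "x = (\<Sum>c\<in>C. l c *\<^sub>R c)"
    using spectral_decomposition[of UNIV x] by blast
  have "x \<odot> x = (\<Sum>c\<in>C. (l c)\<^sup>2 *\<^sub>R c)"
    unfolding C(2) idempotent_system_mult[OF C(1)] by (simp add: power2_eq_square)
  moreover have "inner c (y \<odot> y) \<ge> 0" if "c \<in> C" for c
    using idempotent_inner_nonneg[of c y] C that by (simp add: idempotent_system_def inner_mult')
  ultimately show ?thesis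
    by (auto simp: inner_sum_left intro!: sum_nonneg)
qed

subsection \<open>Normals of lattice-like hyperplanes\<close>

text \<open>Moreau decomposition: for an orthogonal splitting into squares, the projection keeps the
  positive part. The sharpened estimate \<open>d\<close> yields minimality and also uniqueness,
  which pins down the choice in \<open>closest_point\<close>.\<close>

lemma cone_sup_orthogonal:
  assumes "inner (v \<odot> v) (w \<odot> w) = 0"
  shows "cone_sup (cone_of_squares (\<odot>)) u (u + (v \<odot> v - w \<odot> w)) = u + v \<odot> v"
proof -
  let ?z = "u + (v \<odot> v - w \<odot> w)"
  let ?S = "{u + q |q. q \<in> cone_of_squares (\<odot>)}"
  have p: "u + v \<odot> v \<in> ?S" by (auto simp: cone_of_squares_def)
  have d: "(dist ?z (u + v \<odot> v))\<^sup>2 + (norm (v \<odot> v - y \<odot> y))\<^sup>2 \<le> (dist ?z (u + y \<odot> y))\<^sup>2" for y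
  proof -
    have "dist ?z (u + y \<odot> y) = norm ((v \<odot> v - y \<odot> y) - w \<odot> w)"
      by (simp add: dist_norm algebra_simps)
    then have "(dist ?z (u + y \<odot> y))\<^sup>2 = (norm (v \<odot> v - y \<odot> y))\<^sup>2
        + (norm (w \<odot> w))\<^sup>2 - 2 * inner (v \<odot> v - y \<odot> y) (w \<odot> w)"
      by (simp add: power2_norm_eq_inner inner_diff_left inner_diff_right inner_commute)
    moreover have "inner (v \<odot> v - y \<odot> y) (w \<odot> w) \<le> 0"
      using assms inner_squares_nonneg[of y w] by (simp add: inner_diff_left)
    moreover have "dist ?z (u + v \<odot> v) = norm (w \<odot> w)" by (simp add: dist_norm)
    ultimately show ?thesis by simp
  qed
  show ?thesis
    unfolding cone_sup_def closest_point_def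
  proof (rule some_equality)
    have "dist ?z (u + v \<odot> v) \<le> dist ?z (u + y \<odot> y)" for y
      using d[of y] zero_le_power2[of "norm (v \<odot> v - y \<odot> y)"]
      by (intro power2_le_imp_le[OF _ zero_le_dist]) linarith
    then show "u + v \<odot> v \<in> ?S \<and> (\<forall>y\<in>?S. dist ?z (u + v \<odot> v) \<le> dist ?z y)"
      using p by (auto simp: cone_of_squares_def)
  next
    fix x assume x: "x \<in> ?S \<and> (\<forall>y\<in>?S. dist ?z x \<le> dist ?z y)"
    then obtain y where y: "x = u + y \<odot> y" by (auto simp: cone_of_squares_def)
    have "dist ?z x \<le> dist ?z (u + v \<odot> v)" using x p by blast
    then have "(dist ?z x)\<^sup>2 \<le> (dist ?z (u + v \<odot> v))\<^sup>2" by (intro power_mono) auto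
    with d[of y] have "(norm (v \<odot> v - y \<odot> y))\<^sup>2 \<le> 0" unfolding y by linarith
    then show "x = u + v \<odot> v" using y by simp
  qed
qed

text \<open>The form in which lattice-likeness enters the rest of the argument: a condition on the
  normal alone.\<close>

definition separates_orthogonal :: "'a \<Rightarrow> bool" where
  "separates_orthogonal a \<longleftrightarrow>
     (\<forall>v w. inner (v \<odot> v) (w \<odot> w) = 0 \<longrightarrow> inner a (v \<odot> v) * inner a (w \<odot> w) \<le> 0)"

lemma lattice_like_hyperplane_separates:
  assumes "lattice_like (cone_of_squares (\<odot>)) (hyperplane u a)"
  shows "separates_orthogonal a"
  unfolding separates_orthogonal_def
proof (intro allI impI, rule ccontr)
  fix v w
  assume vw: "inner (v \<odot> v) (w \<odot> w) = 0" and neg: "\<not> inner a (v \<odot> v) * inner a (w \<odot> w) \<le> 0"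
  \<comment> \<open>Weighting each square by the other one's inner product with \<open>a\<close>
    makes their difference orthogonal to \<open>a\<close>, as the two inner products have the same
    sign.\<close>
  define s where "s = \<bar>inner a (w \<odot> w)\<bar>"
  define t where "t = \<bar>inner a (v \<odot> v)\<bar>"
  let ?v = "sqrt s *\<^sub>R v" and ?w = "sqrt t *\<^sub>R w"
  have vv: "?v \<odot> ?v = s *\<^sub>R (v \<odot> v)" "?w \<odot> ?w = t *\<^sub>R (w \<odot> w)"
    by (simp_all add: jbilinear s_def t_def)
  have "s * inner a (v \<odot> v) = t * inner a (w \<odot> w)"
    using neg by (auto simp: s_def t_def abs_if not_le zero_less_mult_iff)
  then have "u + (?v \<odot> ?v - ?w \<odot> ?w) \<in> hyperplane u a"
    by (simp add: hyperplane_def vv inner_add_right inner_diff_right)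
  moreover have "u \<in> hyperplane u a" by (simp add: hyperplane_def)
  moreover have "inner (?v \<odot> ?v) (?w \<odot> ?w) = 0" using vw by (simp add: vv)
  ultimately have "u + ?v \<odot> ?v \<in> hyperplane u a"
    using assms cone_sup_orthogonal[of ?v ?w u] unfolding lattice_like_def by metis
  then have "s * inner a (v \<odot> v) = 0"
    unfolding vv by (simp add: hyperplane_def inner_add_right)
  then show False using neg by (auto simp: s_def)
qed

lemma separates_idempotents:
  assumes "separates_orthogonal a" "c \<odot> c = c" "d \<odot> d = d" "c \<odot> d = 0"
  shows "inner a c * inner a d \<le> 0"
proof -
  have "inner (c \<odot> c) (d \<odot> d) = 0"
    using assms inner_mult[of c d e] by (simp add: inner_commute)
  then show ?thesis using assms unfolding separates_orthogonal_def by metis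
qed

text \<open>The hypothesis says \<open>inner (c \<odot> v) v = 0\<close>, so \<open>v\<close> lies
  in the Peirce 0-space of \<open>c\<close>, which is closed under products.\<close>

lemma idempotent_annihilates_square:
  assumes c: "c \<odot> c = c" and "inner c (v \<odot> v) = 0"
  shows "c \<odot> (v \<odot> v) = 0"
proof -
  have "c \<odot> v = 0" using assms idempotent_inner_eq_0[of c v] by (simp add: inner_mult')
  then show ?thesis using peirce_0_commute[OF c, of v v] by simp
qed

(* The positive and negative parts of x live in the Peirce 1-space of c + d, so a pairs with both of
   them through c alone, and equally since x is orthogonal to c. *)
lemma separates_peirce_space_trivial:
  assumes sep: "separates_orthogonal a"
    and c: "c \<odot> c = c" and d: "d \<odot> d = d" and cd: "c \<odot> d = 0"
    and a: "a = l *\<^sub>R c + b" "l \<noteq> 0" "c \<odot> b = 0" "d \<odot> b = 0"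
    and x: "2 *\<^sub>R (c \<odot> x) = x" "2 *\<^sub>R (d \<odot> x) = x"
  shows "x = 0"
proof -
  let ?f = "c + d"
  have dc: "d \<odot> c = 0" using cd mult_commute by metis
  have f: "?f \<odot> ?f = ?f" using c d cd dc by (simp add: jbilinear)
  have "2 *\<^sub>R (?f \<odot> x) = 2 *\<^sub>R x" unfolding jadd_left scaleR_add_right x by (simp add: scaleR_2)
  then have "x \<in> {y. ?f \<odot> y = y}" by simp
  then obtain v w where vw: "?f \<odot> v = v" "?f \<odot> w = w" "x = v \<odot> v - w \<odot> w"
      "inner (v \<odot> v) (w \<odot> w) = 0"
    using positive_negative_parts[OF subalgebra_peirce_1[OF f]] by blast
  have a_inner: "inner a y = l * inner c y" if "?f \<odot> y = y" for y
  proof -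
    have "inner b y = inner (?f \<odot> b) y" using that by (metis inner_mult)
    then show ?thesis using a by (simp add: jbilinear inner_add_left)
  qed
  have "?f \<odot> (v \<odot> v) = v \<odot> v" "?f \<odot> (w \<odot> w) = w \<odot> w"
    using peirce_1_commute[OF f] vw by simp_all
  then have prod: "(l * inner c (v \<odot> v)) * (l * inner c (w \<odot> w)) \<le> 0"
    using sep vw(4) a_inner unfolding separates_orthogonal_def by metis
  have "inner c x = 2 * inner c (d \<odot> x)" by (subst x(2)[symmetric]) simp
  then have "inner c x = 0" by (simp add: inner_mult' cd)
  then have eq: "inner c (v \<odot> v) = inner c (w \<odot> w)" using vw by (simp add: inner_diff_right)
  have "(l * inner c (v \<odot> v))\<^sup>2 \<le> 0" using prod by (simp add: power2_eq_square eq)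
  then have "inner c (v \<odot> v) = 0" "inner c (w \<odot> w) = 0" using a(2) eq by simp_all
  then have "c \<odot> x = 0"
    using idempotent_annihilates_square[OF c] vw by (simp add: jbilinear)
  then show ?thesis using x(1) by simp
qed

section \<open>Peirce decomposition and simplicity\<close>

lemma peirce_cubic_solved:
  assumes c: "c \<odot> c = c"
  shows "c \<odot> (c \<odot> (c \<odot> x)) = (1/2) *\<^sub>R (3 *\<^sub>R (c \<odot> (c \<odot> x)) - c \<odot> x)"
proof -
  have "2 *\<^sub>R (c \<odot> (c \<odot> (c \<odot> x))) = 3 *\<^sub>R (c \<odot> (c \<odot> x)) - c \<odot> x"
    using peirce_cubic[OF c, of x] by (simp add: algebra_simps)
  then show ?thesis
    by (metis divide_self_if scaleR_scaleR scaleR_one times_divide_eq_left mult_1 zero_neq_numeral)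
qed

text \<open>The components are the Lagrange polynomials for the nodes 1, 1/2, 0, evaluated at
  multiplication by \<open>c\<close> and applied to \<open>x\<close>.\<close>

lemma peirce_decomposition:
  assumes c: "c \<odot> c = c"
  obtains y z w where "x = y + z + w" "c \<odot> y = y" "2 *\<^sub>R (c \<odot> z) = z" "c \<odot> w = 0"
proof
  let ?p = "c \<odot> x" and ?q = "c \<odot> (c \<odot> x)"
  note q = peirce_cubic_solved[OF c, of x]
  show "x = (2 *\<^sub>R ?q - ?p) + (4 *\<^sub>R ?p - 4 *\<^sub>R ?q) + (x - 3 *\<^sub>R ?p + 2 *\<^sub>R ?q)"
    by (rule vector_eq_rdot[THEN iffD1]) (simp add: inner_add_left inner_diff_left)
  show "c \<odot> (2 *\<^sub>R ?q - ?p) = 2 *\<^sub>R ?q - ?p"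
    by (rule vector_eq_rdot[THEN iffD1]) (simp add: jbilinear q inner_diff_left)
  show "2 *\<^sub>R (c \<odot> (4 *\<^sub>R ?p - 4 *\<^sub>R ?q)) = 4 *\<^sub>R ?p - 4 *\<^sub>R ?q"
    by (rule vector_eq_rdot[THEN iffD1]) (simp add: jbilinear q inner_diff_left)
  show "c \<odot> (x - 3 *\<^sub>R ?p + 2 *\<^sub>R ?q) = 0"
    by (rule vector_eq_rdot[THEN iffD1])
      (simp add: jbilinear q inner_diff_left inner_add_left)
qed

text \<open>Without a Peirce 1/2-space, the algebra is the sum of the 1-space and the 0-space of
  \<open>c\<close>, which annihilate each other; so the 1-space is an ideal.\<close>

lemma simple_idempotent_trivial:
  assumes simple: "simple_jordan (\<odot>)" and c: "c \<odot> c = c"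
    and half: "\<And>x. 2 *\<^sub>R (c \<odot> x) = x \<Longrightarrow> x = 0"
  shows "c = 0 \<or> c = e"
proof -
  have "y \<odot> x \<in> {y. c \<odot> y = y}" if y: "c \<odot> y = y" for x y
  proof -
    obtain x1 xh x0 where x: "x = x1 + xh + x0" "c \<odot> x1 = x1" "2 *\<^sub>R (c \<odot> xh) = xh" "c \<odot> x0 = 0"
      using peirce_decomposition[OF c] .
    have "y \<odot> x0 = 0" using peirce_0_1_orthogonal[OF c x(4) y] mult_commute by metis
    moreover have "xh = 0" using half x by blast
    ultimately show ?thesis using peirce_1_commute[OF c y, of x1] x by (simp add: jbilinear)
  qed
  then have "jordan_ideal (\<odot>) {y. c \<odot> y = y}"
    using subalgebra_peirce_1[OF c] by (auto simp: jordan_ideal_def subalgebra_def)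
  then have "{y. c \<odot> y = y} = {0} \<or> {y. c \<odot> y = y} = UNIV"
    using simple unfolding simple_jordan_def by blast
  then show ?thesis
  proof
    assume "{y. c \<odot> y = y} = {0}"
    then show ?thesis using c by blast
  next
    assume "{y. c \<odot> y = y} = UNIV"
    then have "c \<odot> e = e" by blast
    then show ?thesis by simp
  qed
qed

section \<open>One-dimensional Peirce spaces and the quadratic equation\<close>

text \<open>A spectral idempotent \<open>d\<close> of \<open>y\<close> is orthogonal to
  \<open>c - d\<close>, so \<open>prim\<close> gives \<open>d = c\<close>: the decomposition has at
  most one term.\<close>

lemma peirce_1_line:
  assumes c: "c \<odot> c = c"
    and prim: "\<And>d f. d \<odot> d = d \<Longrightarrow> f \<odot> f = f \<Longrightarrow> c \<odot> d = d \<Longrightarrow> c \<odot> f = f \<Longrightarrow> d \<odot> f = 0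
      \<Longrightarrow> d = 0 \<or> f = 0"
    and y: "c \<odot> y = y"
  shows "\<exists>k. y = k *\<^sub>R c"
proof -
  obtain C l where C: "idempotent_system C" "C \<subseteq> {y. c \<odot> y = y}" "y = (\<Sum>d\<in>C. l d *\<^sub>R d)"
    using spectral_decomposition[OF subalgebra_peirce_1[OF c]] y by blast
  have "C \<subseteq> {c}"
  proof
    fix d assume d: "d \<in> C"
    have "d \<odot> d = d" "c \<odot> d = d" "d \<noteq> 0" using d C by (auto simp: idempotent_system_def)
    moreover have "c - d = 0"
      using prim[of d "c - d"] calculation c mult_commute[of d c] by (simp add: jbilinear)
    ultimately show "d \<in> {c}" by simp
  qed
  then have "C = {} \<or> C = {c}" by blast
  then show ?thesis using C(3) by (auto intro: exI[of _ 0])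
qed

text \<open>On idempotents \<open>g\<close> of the 1-space of \<open>c\<close>, \<open>a\<close>
  takes the value \<open>l * inner g g\<close>. These values have one sign, so no two nonzero ones
  can be orthogonal.\<close>

lemma separates_peirce_1_line:
  assumes sep: "separates_orthogonal a" and c: "c \<odot> c = c"
    and a: "a = l *\<^sub>R c + b" "l \<noteq> 0" "c \<odot> b = 0"
    and y: "c \<odot> y = y"
  shows "\<exists>k. y = k *\<^sub>R c"
proof (rule peirce_1_line[OF c _ y])
  fix d f
  assume d: "d \<odot> d = d" "f \<odot> f = f" "c \<odot> d = d" "c \<odot> f = f" "d \<odot> f = 0"
  have *: "inner a g = l * inner g g" if "g \<odot> g = g" "c \<odot> g = g" for g
  proof -
    have "inner b g = 0" using that a(3) by (metis inner_mult inner_zero_left)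
    moreover have "inner c g = inner g g" using that by (metis inner_mult mult_commute)
    ultimately show ?thesis by (simp add: a inner_add_left)
  qed
  have "(l * inner d d) * (l * inner f f) \<le> 0"
    using separates_idempotents[OF sep d(1,2,5)] * d by simp
  then have "(l * l) * (inner d d * inner f f) \<le> 0" by (simp add: mult_ac)
  moreover have "l * l > 0" using a(2) by (simp add: zero_less_mult_iff) linarith
  ultimately have "inner d d * inner f f \<le> 0" by (meson mult_pos_pos not_le)
  then show "d = 0 \<or> f = 0" by (metis inner_gt_zero_iff mult_pos_pos not_le)
qed

text \<open>The square of a 1/2-space element has no 1/2-component: in the linearized identity the
  multiples of \<open>v \<odot> v\<close> itself cancel.\<close>

lemma peirce_half_square:
  assumes c: "c \<odot> c = c" and v: "2 *\<^sub>R (c \<odot> v) = v"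
  shows "c \<odot> (c \<odot> (v \<odot> v)) = c \<odot> (v \<odot> v)"
proof -
  have cv: "c \<odot> v = (1/2) *\<^sub>R v" using v by (metis scaleR_half_double scaleR_2 scaleR_right_distrib)
  have vc: "v \<odot> c = (1/2) *\<^sub>R v" using cv mult_commute by metis
  show ?thesis
    using linearized_jordan[of c v v c]
    by (simp add: c cv vc jbilinear mult_commute[of "v \<odot> v" c])
qed

text \<open>Write \<open>x\<close> as \<open>\<alpha> *\<^sub>R c + v + \<beta> *\<^sub>R d\<close>.
  Once \<open>v \<odot> v = r *\<^sub>R e\<close> is known, \<open>x\<close> satisfies a
  Cayley-Hamilton equation with trace \<open>\<alpha> + \<beta>\<close> and determinant
  \<open>\<alpha> * \<beta> - r\<close>.\<close>

lemma rank_two_quadratic: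
  assumes c: "c \<odot> c = c"
    and line1: "\<And>y. c \<odot> y = y \<Longrightarrow> \<exists>k. y = k *\<^sub>R c"
    and line0: "\<And>y. c \<odot> y = 0 \<Longrightarrow> \<exists>k. y = k *\<^sub>R (e - c)"
  shows "\<exists>t s. x \<odot> x = t *\<^sub>R x + s *\<^sub>R e"
proof -
  define d where "d = e - c"
  have ce: "e = c + d" by (simp add: d_def)
  have cd: "c \<odot> d = 0" "d \<odot> c = 0" "d \<odot> d = d"
    using c by (simp_all add: d_def jbilinear)
  obtain y v w where x: "x = y + v + w" "c \<odot> y = y" "2 *\<^sub>R (c \<odot> v) = v" "c \<odot> w = 0"
    using peirce_decomposition[OF c] .
  obtain \<alpha> \<beta> where y: "y = \<alpha> *\<^sub>R c" and w: "w = \<beta> *\<^sub>R d"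
    using line1[OF x(2)] line0[OF x(4)] unfolding d_def by blast
  have cv: "c \<odot> v = (1/2) *\<^sub>R v"
    using x(3) by (metis scaleR_half_double scaleR_2 scaleR_right_distrib)
  have dv: "d \<odot> v = (1/2) *\<^sub>R v"
    unfolding d_def jdiff_left cv
    by (rule vector_eq_rdot[THEN iffD1]) (simp add: inner_diff_left)
  have vc: "v \<odot> c = (1/2) *\<^sub>R v" "v \<odot> d = (1/2) *\<^sub>R v" using cv dv mult_commute by metis+
  have half: "c \<odot> (c \<odot> (v \<odot> v)) = c \<odot> (v \<odot> v)" by (rule peirce_half_square[OF c x(3)])
  obtain s where s: "c \<odot> (v \<odot> v) = s *\<^sub>R c" using line1[OF half] by blast
  have "c \<odot> (v \<odot> v - c \<odot> (v \<odot> v)) = 0" using half by (simp add: jbilinear)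
  then obtain t where "v \<odot> v - c \<odot> (v \<odot> v) = t *\<^sub>R d" using line0 unfolding d_def by blast
  then have vv: "v \<odot> v = s *\<^sub>R c + t *\<^sub>R d" using s by (simp add: algebra_simps)
  have vvv: "(v \<odot> v) \<odot> v = ((s + t) / 2) *\<^sub>R v"
    unfolding vv by (rule vector_eq_rdot[THEN iffD1])
      (simp add: jbilinear cv dv inner_add_left algebra_simps add_divide_distrib)
  \<comment> \<open>The Jordan identity at \<open>v\<close>, \<open>v\<close>. Comparing the
    coefficients of \<open>c\<close> and \<open>d\<close> on both sides will force
    \<open>s = t\<close>.\<close>
  have vvvv: "(v \<odot> v) \<odot> (v \<odot> v) = ((s + t) / 2) *\<^sub>R (v \<odot> v)"
    by (simp add: jordan_identity vvv jbilinear)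
  have "\<exists>r. v \<odot> v = r *\<^sub>R e"
  proof (cases "c = 0 \<or> d = 0")
    \<comment> \<open>Coefficients cannot be compared here, but the other idempotent is then
      \<open>e\<close>.\<close>
    case True
    then show ?thesis unfolding vv ce by auto
  next
    case False
    have "(s * s) *\<^sub>R c + (t * t) *\<^sub>R d = ((s + t) / 2 * s) *\<^sub>R c + ((s + t) / 2 * t) *\<^sub>R d"
      using vvvv unfolding vv by (simp add: jbilinear c cd scaleR_add_right)
    then have *: "c \<odot> ((s * s) *\<^sub>R c + (t * t) *\<^sub>R d) = c \<odot> (((s + t) / 2 * s) *\<^sub>R c + ((s + t) / 2 * t) *\<^sub>R d)"
      "d \<odot> ((s * s) *\<^sub>R c + (t * t) *\<^sub>R d) = d \<odot> (((s + t) / 2 * s) *\<^sub>R c + ((s + t) / 2 * t) *\<^sub>R d)"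
      by simp_all
    have "s * s = (s + t) / 2 * s" "t * t = (s + t) / 2 * t"
      using * False by (simp_all add: jbilinear c cd)
    then have "s = t" by (auto simp: field_simps)
    then show ?thesis unfolding vv ce by (auto simp: scaleR_add_right)
  qed
  then obtain r where r: "v \<odot> v = r *\<^sub>R e" by blast
  have "x \<odot> x = (\<alpha> + \<beta>) *\<^sub>R x + (r - \<alpha> * \<beta>) *\<^sub>R e"
    unfolding x(1) y w
    by (rule vector_eq_rdot[THEN iffD1])
      (simp add: jbilinear c cd cv dv vc r inner_add_left inner_diff_left ce algebra_simps)
  then show ?thesis by blast
qed

section \<open>Spectral shape of the normal\<close>

text \<open>Any two nonzero spectral coefficients of \<open>a\<close> have strictly opposite signs,
  and three reals cannot do so pairwise. The alternative \<open>d = 0\<close> stands for a single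
  term.\<close>

lemma separates_two_idempotents:
  assumes sep: "separates_orthogonal a" and "a \<noteq> 0"
  obtains c d l m where "c \<odot> c = c" "d \<odot> d = d" "c \<odot> d = 0" "c \<noteq> 0"
    "a = l *\<^sub>R c + m *\<^sub>R d" "l \<noteq> 0" "d = 0 \<or> m \<noteq> 0"
proof -
  have "subalgebra UNIV" by (simp add: subalgebra_def)
  then obtain C k where C: "idempotent_system C" and a: "a = (\<Sum>c\<in>C. k c *\<^sub>R c)"
    using spectral_decomposition[of UNIV a] by blast
  \<comment> \<open>The spectral decomposition may contain zero coefficients.\<close>
  define P where "P = {c\<in>C. k c \<noteq> 0}"
  have fin: "finite C" using C by (simp add: idempotent_system_def)
  have aP: "a = (\<Sum>c\<in>P. k c *\<^sub>R c)"
    unfolding a P_def by (rule sum.mono_neutral_right) (use fin in auto)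
  have P: "c \<odot> c = c" "c \<noteq> 0" "k c \<noteq> 0" "c \<in> C" if "c \<in> P" for c
    using that C by (auto simp: P_def idempotent_system_def)
  have orth: "c \<odot> d = 0" if "c \<in> P" "d \<in> P" "c \<noteq> d" for c d
    using that C by (auto simp: P_def idempotent_system_def)
  have inner_a: "inner a c = k c * inner c c" if "c \<in> P" for c
  proof -
    have "inner d c = 0" if "d \<in> P" "d \<noteq> c" for d
      using inner_mult[of d c e] orth[OF that(1) \<open>c \<in> P\<close> that(2)] by (simp add: inner_commute)
    then have "inner a c = (\<Sum>d\<in>P. if d = c then k c * inner c c else 0)"
      unfolding aP inner_sum_left by (intro sum.cong) auto
    then show ?thesis using that fin by (simp add: P_def)
  qed
  have neg: "k c * k d < 0" if "c \<in> P" "d \<in> P" "c \<noteq> d" for c d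
  proof -
    have "(k c * inner c c) * (k d * inner d d) \<le> 0"
      using separates_idempotents[OF sep P(1) P(1) orth] that inner_a by simp
    then have "(k c * k d) * (inner c c * inner d d) \<le> 0" by (simp add: mult_ac)
    moreover have "inner c c * inner d d > 0" using P that by simp
    ultimately have "k c * k d \<le> 0" by (meson mult_pos_pos not_le)
    then show ?thesis using P(3) that by (metis less_eq_real_def mult_eq_0_iff)
  qed
  have "P \<noteq> {}" using aP \<open>a \<noteq> 0\<close> by auto
  then obtain c where c: "c \<in> P" by blast
  show thesis
  proof (cases "P = {c}")
    case True
    then show thesis using that[of c 0 "k c" 0] P[OF c] aP by simp
  next
    case False
    then obtain d where d: "d \<in> P" "c \<noteq> d" using c by blast
    have "f = c \<or> f = d" if f: "f \<in> P" for f
    proof (rule ccontr)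
      assume "\<not> (f = c \<or> f = d)"
      then have "k c * k f < 0" "k d * k f < 0" using neg c d(1) f by metis+
      then show False using neg[OF c d] by (auto simp: mult_less_0_iff)
    qed
    then have "P = {c, d}" using c d by blast
    then show thesis using that[of c d "k c" "k d"] P[OF c] P[OF d(1)] aP d orth[OF c d] by simp
  qed
qed

subsection \<open>Jordan frames\<close>

lemma unit_nonzero: "e \<noteq> 0"
proof
  assume "e = 0"
  then have "x = 0" for x :: 'a using mult_unit[of x] by simp
  then show False using nonempty_Basis nonzero_Basis by blast
qed

lemma idempotent_system_card_le:
  assumes "idempotent_system C"
  shows "card C \<le> DIM('a)"
proof -
  have "inner c d = 0" if "c \<in> C" "d \<in> C" "c \<noteq> d" for c d
    using inner_mult[of c d e] assms that by (simp add: idempotent_system_def inner_commute)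
  then have "pairwise orthogonal C" by (simp add: pairwise_def orthogonal_def)
  moreover have "0 \<notin> C" using assms by (auto simp: idempotent_system_def)
  ultimately show ?thesis using pairwise_orthogonal_independent independent_bound by blast
qed

text \<open>Among the idempotent systems with sum \<open>e\<close>, bounded in size by the
  dimension, take a largest one: a non-primitive member could be replaced by its two summands.
  Existence makes the choice in \<open>jordan_rank\<close> meaningful.\<close>

lemma jordan_frame_exists: "\<exists>C. jordan_frame (\<odot>) e C"
proof -
  let ?P = "\<lambda>C. idempotent_system C \<and> \<Sum>C = e"
  have "?P {e}" using unit_nonzero by (simp add: idempotent_system_def)
  moreover have "\<forall>C. ?P C \<longrightarrow> card C < Suc (DIM('a))"
    using idempotent_system_card_le by (simp add: less_Suc_eq_le)
  ultimately obtain C where C: "?P C" and max: "\<And>D. ?P D \<Longrightarrow> card D \<le> card C"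
    using ex_has_greatest_nat[of ?P "{e}" card "Suc (DIM('a))"] by blast
  have C': "finite C" "\<And>c. c \<in> C \<Longrightarrow> c \<odot> c = c" "\<And>c. c \<in> C \<Longrightarrow> c \<noteq> 0"
      "\<And>c d. c \<in> C \<Longrightarrow> d \<in> C \<Longrightarrow> c \<noteq> d \<Longrightarrow> c \<odot> d = 0"
    using C by (auto simp: idempotent_system_def)
  have "primitive_idempotent (\<odot>) c" if c: "c \<in> C" for c
  proof (rule ccontr)
    assume "\<not> primitive_idempotent (\<odot>) c"
    then obtain p q where p: "p \<odot> p = p" "p \<noteq> 0" and q: "q \<odot> q = q" "q \<noteq> 0" and cpq: "c = p + q"
      using c C' by (auto simp: primitive_idempotent_def jordan_idempotent_def)
    have qp: "q \<odot> p = p \<odot> q" by (rule mult_commute)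
    have "p \<odot> q + p \<odot> q = 0"
      using C'(2)[OF c] unfolding cpq by (simp add: jbilinear p q qp algebra_simps)
    then have pq: "p \<odot> q = 0" by (metis scaleR_2 scaleR_eq_0_iff zero_neq_numeral)
    have cp: "c \<odot> p = p" "c \<odot> q = q" by (simp_all add: cpq jbilinear p q pq qp)
    \<comment> \<open>\<open>d\<close> lies in the Peirce 0-space of \<open>c\<close>, while
      \<open>p\<close> and \<open>q\<close> lie in its 1-space.\<close>
    have orth: "d \<odot> p = 0" "d \<odot> q = 0" "p \<odot> d = 0" "q \<odot> d = 0" if d: "d \<in> C - {c}" for d
    proof -
      have cd: "c \<odot> d = 0" using C'(4) c d by auto
      show "d \<odot> p = 0" "d \<odot> q = 0"
        using peirce_0_1_orthogonal[OF C'(2)[OF c] cd] cp by blast+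
      then show "p \<odot> d = 0" "q \<odot> d = 0" by (simp_all add: mult_commute)
    qed
    have "p \<noteq> q" using p q pq by auto
    have notin: "p \<notin> C - {c}" "q \<notin> C - {c}" using orth p q by metis+
    let ?D = "insert p (insert q (C - {c}))"
    have "idempotent_system ?D"
      unfolding idempotent_system_def
      using C' p q pq qp orth by auto
    moreover have "\<Sum>?D = e"
    proof -
      have "\<Sum>?D = p + (q + \<Sum>(C - {c}))"
        using notin \<open>p \<noteq> q\<close> C'(1) by simp
      also have "\<dots> = c + \<Sum>(C - {c})" by (simp add: cpq)
      also have "\<dots> = e" using sum.remove[OF C'(1) c, of "\<lambda>x. x"] C by simp
      finally show ?thesis .
    qed
    ultimately have "card ?D \<le> card C" using max by blast
    moreover have "card ?D = Suc (Suc (card (C - {c})))"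
      using notin \<open>p \<noteq> q\<close> C'(1) by simp
    moreover have "card C = Suc (card (C - {c}))" using c C'(1) by (metis card_Suc_Diff1)
    ultimately show False by simp
  qed
  then have "jordan_frame (\<odot>) e C" using C C' by (simp add: jordan_frame_def)
  then show ?thesis by blast
qed

lemma quadratic_frame_card:
  assumes quad: "\<And>x. \<exists>t s. x \<odot> x = t *\<^sub>R x + s *\<^sub>R e" and C: "idempotent_system C"
  shows "card C < 3"
proof (rule ccontr)
  assume "\<not> card C < 3"
  then obtain T where "T \<subseteq> C" "card T = 3"
    using obtain_subset_with_card_n[of 3 C] by auto
  then obtain p q r where sub: "p \<in> C" "q \<in> C" "r \<in> C" and ne: "p \<noteq> q" "q \<noteq> r" "p \<noteq> r"
    by (auto simp: card_3_iff)
  have idem: "p \<odot> p = p" "q \<odot> q = q" "r \<odot> r = r" and nz: "p \<noteq> 0" "q \<noteq> 0" "r \<noteq> 0"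
    and orth: "p \<odot> q = 0" "q \<odot> p = 0" "p \<odot> r = 0" "r \<odot> p = 0" "q \<odot> r = 0" "r \<odot> q = 0"
    using C sub ne by (auto simp: idempotent_system_def)
  \<comment> \<open>This element has the three eigenvalues 1, 2, 0 on \<open>p\<close>,
    \<open>q\<close>, \<open>r\<close>, one too many for a quadratic equation.\<close>
  let ?x = "p + 2 *\<^sub>R q"
  obtain t s where "?x \<odot> ?x = t *\<^sub>R ?x + s *\<^sub>R e" using quad by blast
  then have eq: "p + 4 *\<^sub>R q = t *\<^sub>R p + (2 * t) *\<^sub>R q + s *\<^sub>R e"
    by (simp add: jbilinear idem orth scaleR_add_right mult_ac)
  have "1 *\<^sub>R p = (t + s) *\<^sub>R p" "4 *\<^sub>R q = (2 * t + s) *\<^sub>R q" "0 *\<^sub>R r = s *\<^sub>R r"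
    using arg_cong[OF eq, of "\<lambda>y. p \<odot> y"] arg_cong[OF eq, of "\<lambda>y. q \<odot> y"]
      arg_cong[OF eq, of "\<lambda>y. r \<odot> y"]
    by (simp_all add: jbilinear idem orth scaleR_add_left)
  then have "1 = t + s" "4 = 2 * t + s" "0 = s"
    using nz unfolding scaleR_cancel_right by blast+
  then show False by simp
qed

text \<open>Multiplication by \<open>c\<close> carries the 1/2-space of \<open>f\<close> into the
  joint 1/2-space of \<open>c\<close> and \<open>f\<close>, where
  \<open>separates_peirce_space_trivial\<close> applies.\<close>

lemma peirce_half_component:
  assumes c: "c \<odot> c = c" and f: "f \<odot> f = f" and cf: "c \<odot> f = 0" and x: "2 *\<^sub>R (f \<odot> x) = x"
  shows "2 *\<^sub>R (c \<odot> (c \<odot> x)) = c \<odot> x" "2 *\<^sub>R (f \<odot> (c \<odot> x)) = c \<odot> x"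
proof -
  have fc: "f \<odot> c = 0" using cf mult_commute by metis
  have half: "2 *\<^sub>R (f \<odot> (c \<odot> y)) = c \<odot> y" if "2 *\<^sub>R (f \<odot> y) = y" for y
    using peirce_0_commute[OF f fc, of y] that by (metis jscale_right)
  show *: "2 *\<^sub>R (f \<odot> (c \<odot> x)) = c \<odot> x" using half[OF x] .
  \<comment> \<open>The Peirce 1-component of \<open>x\<close> for \<open>c\<close>: it lies in the
    1/2-space of \<open>f\<close>, yet \<open>f\<close>, being in the 0-space of \<open>c\<close>,
    annihilates it.\<close>
  let ?y = "2 *\<^sub>R (c \<odot> (c \<odot> x)) - c \<odot> x"
  have "2 *\<^sub>R (f \<odot> ?y) = 2 *\<^sub>R (2 *\<^sub>R (f \<odot> (c \<odot> (c \<odot> x)))) - 2 *\<^sub>R (f \<odot> (c \<odot> x))"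
    by (simp add: jbilinear scaleR_diff_right)
  then have "2 *\<^sub>R (f \<odot> ?y) = ?y" unfolding half[OF *] * .
  moreover have "c \<odot> ?y = ?y"
    by (rule vector_eq_rdot[THEN iffD1])
      (simp add: jbilinear peirce_cubic_solved[OF c] inner_diff_left)
  then have "f \<odot> ?y = 0" using peirce_0_1_orthogonal[OF c cf] by blast
  ultimately have "?y = 0" by simp
  then show "2 *\<^sub>R (c \<odot> (c \<odot> x)) = c \<odot> x" by simp
qed

section \<open>Vanishing of the normal\<close>

lemma separates_orthogonal_imp_zero:
  assumes simple: "simple_jordan (\<odot>)" and frame: "idempotent_system C" "card C \<ge> 3"
    and sep: "separates_orthogonal a"
  shows "a = 0"
proof (rule ccontr)
  assume "a \<noteq> 0"
  then obtain c d l m where c: "c \<odot> c = c" and d: "d \<odot> d = d" and cd: "c \<odot> d = 0" and "c \<noteq> 0"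
    and a: "a = l *\<^sub>R c + m *\<^sub>R d" "l \<noteq> 0" and dm: "d = 0 \<or> m \<noteq> 0"
    using separates_two_idempotents[OF sep] by metis
  define f where "f = e - c - d"
  have dc: "d \<odot> c = 0" using cd mult_commute by metis
  have f: "f \<odot> f = f" and cf: "c \<odot> f = 0" and df: "d \<odot> f = 0" and fc: "f \<odot> c = 0" and fd: "f \<odot> d = 0"
    using c d cd dc by (simp_all add: f_def jbilinear)
  have a': "a = m *\<^sub>R d + l *\<^sub>R c" using a by simp
  show False
  proof (cases "f = 0")
    case True
    then have d_eq: "d = e - c" by (simp add: f_def)
    have "\<exists>k. y = k *\<^sub>R c" if "c \<odot> y = y" for y
      using separates_peirce_1_line[OF sep c a _ that] by (simp add: jbilinear cd)
    moreover have "\<exists>k. y = k *\<^sub>R (e - c)" if "c \<odot> y = 0" for y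
    proof -
      have y: "d \<odot> y = y" using that by (simp add: d_eq jbilinear)
      show ?thesis
      proof (cases "d = 0")
        case True
        then show ?thesis using y by (auto intro: exI[of _ 0])
      next
        case False
        then show ?thesis
          using separates_peirce_1_line[OF sep d a' _ _ y] dm unfolding d_eq[symmetric]
          by (simp add: jbilinear dc)
      qed
    qed
    ultimately have "card C < 3"
      using quadratic_frame_card[OF rank_two_quadratic[OF c] frame(1)] by blast
    then show False using frame by simp
  next
    case False
    have "x = 0" if x: "2 *\<^sub>R (f \<odot> x) = x" for x
    proof -
      have "c \<odot> x = 0"
        using separates_peirce_space_trivial[OF sep c f cf a _ _ peirce_half_component[OF c f cf x]]
        by (simp add: jbilinear cd fd)
      moreover have "d \<odot> x = 0"
        using dm separates_peirce_space_trivial[OF sep d f df a' _ _ _ peirce_half_component[OF d f df x]]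
        by (auto simp: jbilinear dc fc)
      \<comment> \<open>With its products with \<open>c\<close> and \<open>d\<close> gone,
        \<open>x\<close> is fixed by \<open>f = e - c - d\<close>, but \<open>f\<close> also halves
        it.\<close>
      ultimately have "f \<odot> x = x" by (simp add: f_def jbilinear)
      then show ?thesis using x by (simp add: scaleR_2)
    qed
    then have "f = e" using simple_idempotent_trivial[OF simple f] False by blast
    then show False using cf \<open>c \<noteq> 0\<close> by simp
  qed
qed

end

theorem theorem4:
  fixes jmul :: "'a::euclidean_space \<Rightarrow> 'a \<Rightarrow> 'a" and e :: 'a
  assumes "euclidean_jordan_algebra jmul e"
    and "simple_jordan jmul"
    and "jordan_rank jmul e \<ge> 3"
  shows "\<not> (\<exists>u a. a \<noteq> 0 \<and> lattice_like (cone_of_squares jmul) (hyperplane u a))"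
proof -
  interpret euclidean_jordan_algebra jmul e by (rule assms(1))
  define C where "C = (SOME C. jordan_frame jmul e C)"
  \<comment> \<open>Since frames exist, the frame chosen in \<open>jordan_rank\<close> is a genuine
    one.\<close>
  have "jordan_frame jmul e C" unfolding C_def using someI_ex[OF jordan_frame_exists] .
  then have "idempotent_system C"
    by (auto simp: jordan_frame_def idempotent_system_def primitive_idempotent_def jordan_idempotent_def)
  moreover have "card C \<ge> 3" using assms(3) by (simp add: jordan_rank_def C_def)
  ultimately show ?thesis
    using separates_orthogonal_imp_zero[OF assms(2)] lattice_like_hyperplane_separates by blast
qed

end
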